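(* Let $p$ be a prime. For every constant $\varepsilon>0$ there is a constant $\beta>0$ (depending only on $p$ and $\varepsilon$) such that for every positive integer $n$, $$\mathcal{R}^{\mathrm{bool},p}_{M_n}(\beta\log n)\;\ge\;4^n\left(\frac12-\frac{1}{n^{1/2-\varepsilon}}\right).$$
   Context: $\mathbb{F}_p$ is the field with $p$ elements; $\log$ is base 2. For $x\in\mathbb{F}_p$ define $\mathrm{bool}(x)=1$ if $x=1$ in $\mathbb{F}_p$ and $\mathrm{bool}(x)=-1$ otherwise. For $A\in\{-1,1\}^{N\times N}$ and real $r\ge0$, the Boolean rigidity $\mathcal{R}^{\mathrm{bool},p}_{A}(r)$ is the minimum, over all $L\in\mathbb{F}_p^{N\times N}$ with $\mathbb{F}_p$-rank at most $r$, of the number of pairs $(i,j)$ with $A[i,j]\neq\mathrm{bool}(L[i,j])$. The distance matrix $M_n$ is the $2^n\times 2^n$ matrix with rows and columns indexed by $\{0,1\}^n$ and $M_n[x,y]=1$ if the Hamming distance between $x$ and $y$ is at most $n/2$, and $M_n[x,y]=-1$ otherwise. *)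

theory Defs
  imports
    Complex_Main
    "Jordan_Normal_Form.DL_Rank"
    "Berlekamp_Zassenhaus.Finite_Field"
begin

text \<open>The field with \<open>p\<close> elements is \<^typ>\<open>'p::prime_card mod_ring\<close>, the integers modulo
  \<open>p = CARD('p)\<close>; the class \<^class>\<open>prime_card\<close> says that \<open>CARD('p)\<close> is prime.\<close>

definition bool_sign :: "'p::prime_card mod_ring \<Rightarrow> int" where
  "bool_sign x = (if x = 1 then 1 else -1)"

definition bool_errors :: "int mat \<Rightarrow> 'p::prime_card mod_ring mat \<Rightarrow> nat" where
  "bool_errors A L =
     card {(i, j). i < dim_row A \<and> j < dim_col A \<and> A $$ (i, j) \<noteq> bool_sign (L $$ (i, j))}"

text \<open>The minimum is over a nonempty set whenever \<open>r \<ge> 0\<close>, since the zero matrix has rank 0.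
  The first argument of \<^const>\<open>vec_space.rank\<close> is the number of rows.\<close>

definition bool_rigidity :: "'p::prime_card itself \<Rightarrow> int mat \<Rightarrow> real \<Rightarrow> nat" where
  "bool_rigidity _ A r =
     (LEAST k. \<exists>L :: 'p mod_ring mat. L \<in> carrier_mat (dim_row A) (dim_col A) \<and>
        real (vec_space.rank (dim_row A) L) \<le> r \<and> k = bool_errors A L)"

text \<open>Points of \<open>{0,1}\<^sup>n\<close> are encoded as the numbers below \<open>2\<^sup>n\<close> via their binary digits.\<close>

definition hamming_dist :: "nat \<Rightarrow> nat \<Rightarrow> nat \<Rightarrow> nat" where
  "hamming_dist n x y = card {k. k < n \<and> bit x k \<noteq> bit y k}"

definition distance_mat :: "nat \<Rightarrow> int mat" where
  "distance_mat n =
     mat (2 ^ n) (2 ^ n) (\<lambda>(x, y). if real (hamming_dist n x y) \<le> real n / 2 then 1 else -1)"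

end

theory Submission
  imports Defs "HOL-Analysis.L2_Norm"
begin

text \<open>
  A matrix \<open>L\<close> of rank \<open>r\<close> over the field with \<open>p\<close> elements has at most \<open>p\<^sup>r\<close> distinct
  columns. The distance matrix is a convolution kernel \<open>f (x + y)\<close> on the cube, so its operator
  norm is its largest unnormalised Walsh coefficient, which for a majority-like \<open>f\<close> is at most
  \<open>2\<^sup>n / \<surd>n\<close>. Grouping equal columns of \<open>L\<close> and applying Cauchy-Schwarz bounds the correlation of
  the distance matrix with the signs of \<open>L\<close> by \<open>4\<^sup>n \<surd>(p\<^sup>r / n)\<close>; the choice
  \<open>\<beta> = 2 \<epsilon> / log 2 p\<close> makes this at most \<open>4\<^sup>n n powr (\<epsilon> - 1/2)\<close>.
\<close>

section \<open>Fourier analysis on the cube of subsets\<close>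

text \<open>For finite \<open>S\<close> this is the character (-1)^|S \<inter> X| of the group of
  sets under symmetric difference. The product form lets sums over \<open>S\<close> factor
  coordinate by coordinate.\<close>

definition walsh :: "'a set \<Rightarrow> 'a set \<Rightarrow> real" where
  "walsh S X = (\<Prod>i\<in>S. if i \<in> X then - 1 else 1)"

lemma walsh_empty [simp]: "walsh {} X = 1"
  by (simp add: walsh_def)

lemma abs_walsh [simp]: "\<bar>walsh S X\<bar> = 1"
  unfolding walsh_def abs_prod by (rule prod.neutral) auto

lemma walsh_sym_diff: "walsh S (sym_diff X Y) = walsh S X * walsh S Y"
  unfolding walsh_def prod.distrib [symmetric] by (rule prod.cong) auto

lemma walsh_insert_right:
  assumes "finite S" "i \<in> S" "i \<notin> X"
  shows "walsh S (insert i X) = - walsh S X"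
proof -
  have "walsh (S - {i}) (insert i X) = walsh (S - {i}) X"
    unfolding walsh_def by (rule prod.cong) auto
  then show ?thesis
    using assms by (simp add: walsh_def prod.remove [of S i])
qed

text \<open>The sum over all \<open>S\<close> is the expansion of a product over \<open>A\<close> of
  factors 1 + 1 or -1 + 1; one element of \<open>X\<close> already makes it vanish.\<close>

lemma sum_walsh:
  assumes "finite A" "X \<subseteq> A"
  shows "(\<Sum>S\<in>Pow A. walsh S X) = (if X = {} then 2 ^ card A else 0)"
proof -
  have "(\<Sum>S\<in>Pow A. walsh S X) = (\<Prod>i\<in>A. (if i \<in> X then - 1 else 1) + 1)"
    unfolding prod_add [OF assms(1)] walsh_def by simp
  also have "\<dots> = (if X = {} then 2 ^ card A else 0)"
    using assms by (auto simp: subset_iff intro!: prod_zero)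
  finally show ?thesis .
qed

lemma walsh_orthogonal:
  assumes "finite A" "X \<subseteq> A" "Y \<subseteq> A"
  shows "(\<Sum>S\<in>Pow A. walsh S X * walsh S Y) = (if X = Y then 2 ^ card A else 0)"
proof -
  have "(\<Sum>S\<in>Pow A. walsh S X * walsh S Y) = (\<Sum>S\<in>Pow A. walsh S (sym_diff X Y))"
    by (simp add: walsh_sym_diff)
  also have "\<dots> = (if sym_diff X Y = {} then 2 ^ card A else 0)"
    using assms by (intro sum_walsh) auto
  also have "sym_diff X Y = {} \<longleftrightarrow> X = Y" by auto
  finally show ?thesis .
qed

text \<open>Unnormalised, so inversion and Parseval each carry a factor
  \<open>2 ^ card A\<close>.\<close>

definition walsh_transform :: "'a set \<Rightarrow> ('a set \<Rightarrow> real) \<Rightarrow> 'a set \<Rightarrow> real" where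
  "walsh_transform A f S = (\<Sum>X\<in>Pow A. f X * walsh S X)"

lemma walsh_inversion:
  assumes "finite A" "Z \<subseteq> A"
  shows "(\<Sum>S\<in>Pow A. walsh_transform A f S * walsh S Z) = 2 ^ card A * f Z"
proof -
  have "(\<Sum>S\<in>Pow A. walsh_transform A f S * walsh S Z)
      = (\<Sum>X\<in>Pow A. \<Sum>S\<in>Pow A. f X * (walsh S X * walsh S Z))"
    unfolding walsh_transform_def sum_distrib_right mult.assoc by (rule sum.swap)
  also have "\<dots> = (\<Sum>X\<in>Pow A. if X = Z then 2 ^ card A * f Z else 0)"
    unfolding sum_distrib_left [symmetric]
    by (rule sum.cong) (use assms in \<open>auto simp: walsh_orthogonal\<close>)
  also have "\<dots> = 2 ^ card A * f Z"
    using assms by simp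
  finally show ?thesis .
qed

lemma walsh_parseval:
  assumes "finite A"
  shows "(\<Sum>S\<in>Pow A. (walsh_transform A f S)\<^sup>2) = 2 ^ card A * (\<Sum>X\<in>Pow A. (f X)\<^sup>2)"
proof -
  have "(\<Sum>S\<in>Pow A. (walsh_transform A f S)\<^sup>2)
      = (\<Sum>S\<in>Pow A. \<Sum>X\<in>Pow A. f X * (walsh_transform A f S * walsh S X))"
    unfolding power2_eq_square
    by (subst (2) walsh_transform_def) (simp add: sum_distrib_left mult_ac)
  also have "\<dots> = (\<Sum>X\<in>Pow A. f X * (\<Sum>S\<in>Pow A. walsh_transform A f S * walsh S X))"
    unfolding sum_distrib_left by (rule sum.swap)
  also have "\<dots> = (\<Sum>X\<in>Pow A. f X * (2 ^ card A * f X))"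
    by (rule sum.cong) (use assms in \<open>auto simp: walsh_inversion\<close>)
  finally show ?thesis
    by (simp add: sum_distrib_left power2_eq_square mult_ac)
qed

section \<open>Correlation with convolution kernels\<close>

text \<open>The characters diagonalise the kernel: inserting the inversion formula for
  \<open>f\<close> and splitting \<open>walsh S (sym_diff X Y)\<close> turns the double sum into a
  single sum of products of three transforms. The first factor is bounded by \<open>c\<close>, the
  other two by Cauchy-Schwarz and Parseval.\<close>

lemma convolution_bilinear_bound:
  assumes "finite A" and c: "\<And>S. S \<subseteq> A \<Longrightarrow> \<bar>walsh_transform A f S\<bar> \<le> c"
  shows "\<bar>\<Sum>X\<in>Pow A. \<Sum>Y\<in>Pow A. f (sym_diff X Y) * g X * h Y\<bar>
    \<le> c * L2_set g (Pow A) * L2_set h (Pow A)"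
proof -
  let ?F = "walsh_transform A f" and ?G = "walsh_transform A g" and ?H = "walsh_transform A h"
  let ?T = "\<Sum>X\<in>Pow A. \<Sum>Y\<in>Pow A. f (sym_diff X Y) * g X * h Y"
  have "0 \<le> c" using c [of "{}"] by simp
  have norm: "L2_set (walsh_transform A k) (Pow A) = sqrt (2 ^ card A) * L2_set k (Pow A)" for k
    by (simp add: L2_set_def walsh_parseval [OF assms(1)] real_sqrt_mult)
  have "2 ^ card A * ?T
      = (\<Sum>X\<in>Pow A. \<Sum>Y\<in>Pow A. (2 ^ card A * f (sym_diff X Y)) * g X * h Y)"
    by (simp add: sum_distrib_left mult_ac)
  also have "\<dots> = (\<Sum>X\<in>Pow A. \<Sum>Y\<in>Pow A.
      (\<Sum>S\<in>Pow A. ?F S * walsh S (sym_diff X Y)) * g X * h Y)"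
    by (intro sum.cong refl, subst walsh_inversion) (use assms in auto)
  also have "\<dots> = (\<Sum>X\<in>Pow A. \<Sum>Y\<in>Pow A. \<Sum>S\<in>Pow A.
      ?F S * ((g X * walsh S X) * (h Y * walsh S Y)))"
    unfolding walsh_sym_diff sum_distrib_right by (simp add: mult_ac)
  also have "\<dots> = (\<Sum>X\<in>Pow A. \<Sum>S\<in>Pow A. \<Sum>Y\<in>Pow A.
      ?F S * ((g X * walsh S X) * (h Y * walsh S Y)))"
    by (intro sum.cong refl sum.swap)
  also have "\<dots> = (\<Sum>S\<in>Pow A. \<Sum>X\<in>Pow A. \<Sum>Y\<in>Pow A.
      ?F S * ((g X * walsh S X) * (h Y * walsh S Y)))"
    by (rule sum.swap)
  also have "\<dots> = (\<Sum>S\<in>Pow A. ?F S * (?G S * ?H S))"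
    unfolding walsh_transform_def [of A g] walsh_transform_def [of A h] sum_product
    by (simp add: sum_distrib_left)
  finally have "2 ^ card A * ?T = (\<Sum>S\<in>Pow A. ?F S * (?G S * ?H S))" .
  moreover have "2 ^ card A * \<bar>?T\<bar> = \<bar>2 ^ card A * ?T\<bar>"
    unfolding abs_mult by (rule arg_cong2 [where f = "(*)"]) simp_all
  ultimately have "2 ^ card A * \<bar>?T\<bar> = \<bar>\<Sum>S\<in>Pow A. ?F S * (?G S * ?H S)\<bar>"
    by (simp only:)
  also have "\<dots> \<le> (\<Sum>S\<in>Pow A. \<bar>?F S * (?G S * ?H S)\<bar>)"
    by (rule sum_abs)
  also have "\<dots> \<le> (\<Sum>S\<in>Pow A. c * (\<bar>?G S\<bar> * \<bar>?H S\<bar>))"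
    unfolding abs_mult by (intro sum_mono mult_right_mono c) auto
  also have "\<dots> \<le> c * (L2_set ?G (Pow A) * L2_set ?H (Pow A))"
    unfolding sum_distrib_left [symmetric]
    by (intro mult_left_mono L2_set_mult_ineq \<open>0 \<le> c\<close>)
  \<comment> \<open>Parseval contributes \<open>sqrt (2 ^ card A)\<close> twice, which cancels the
    factor introduced by inversion.\<close>
  also have "\<dots> = 2 ^ card A * (c * L2_set g (Pow A) * L2_set h (Pow A))"
    by (simp add: norm)
  finally show ?thesis by simp
qed

text \<open>Here \<open>\<kappa>\<close> sorts the columns \<open>Y\<close> into classes, and the
  entry in row \<open>X\<close> depends on \<open>Y\<close> only through its class. Each class
  \<open>b\<close> gives a bilinear form in the vector \<open>t X b\<close> and the indicator of the
  class, of norms at most \<open>sqrt (2 ^ card A)\<close> and the root of the class size.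
  Cauchy-Schwarz over the classes then sums these roots, at the cost of the root of the number of
  classes.\<close>

lemma correlation_few_classes:
  fixes f :: "'a set \<Rightarrow> real" and t :: "'a set \<Rightarrow> 'b \<Rightarrow> real" and \<kappa> :: "'a set \<Rightarrow> 'b"
  assumes "finite A" and c: "\<And>S. S \<subseteq> A \<Longrightarrow> \<bar>walsh_transform A f S\<bar> \<le> c"
    and t: "\<And>X b. \<bar>t X b\<bar> \<le> 1"
  shows "\<bar>\<Sum>X\<in>Pow A. \<Sum>Y\<in>Pow A. f (sym_diff X Y) * t X (\<kappa> Y)\<bar>
    \<le> c * 2 ^ card A * sqrt (card (\<kappa> ` Pow A))"
proof -
  let ?h = "\<lambda>b Y. of_bool (\<kappa> Y = b) :: real"
  let ?D = "\<lambda>b. \<Sum>X\<in>Pow A. \<Sum>Y\<in>Pow A. f (sym_diff X Y) * t X b * ?h b Y"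
  let ?K = "\<kappa> ` Pow A"
  have fin: "finite (Pow A)" using assms(1) by simp
  have "0 \<le> c" using c [of "{}"] by simp
  have t2: "(t X b)\<^sup>2 \<le> 1" for X b
    using t [of X b] by (simp add: abs_square_le_1)
  have norm_t: "L2_set (\<lambda>X. t X b) (Pow A) \<le> sqrt (2 ^ card A)" for b
  proof -
    have "(\<Sum>X\<in>Pow A. (t X b)\<^sup>2) \<le> (\<Sum>X\<in>Pow A. 1)"
      by (rule sum_mono) (rule t2)
    then show ?thesis
      using assms(1) by (simp add: L2_set_def card_Pow)
  qed
  have "(\<Sum>X\<in>Pow A. \<Sum>Y\<in>Pow A. f (sym_diff X Y) * t X (\<kappa> Y))
      = (\<Sum>X\<in>Pow A. \<Sum>Y\<in>Pow A. \<Sum>b\<in>?K. f (sym_diff X Y) * t X b * ?h b Y)"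
    by (intro sum.cong refl) (use fin in \<open>simp add: of_bool_def if_distrib cong: if_cong\<close>)
  also have "\<dots> = (\<Sum>X\<in>Pow A. \<Sum>b\<in>?K. \<Sum>Y\<in>Pow A. f (sym_diff X Y) * t X b * ?h b Y)"
    by (intro sum.cong refl sum.swap)
  also have "\<dots> = (\<Sum>b\<in>?K. ?D b)"
    by (rule sum.swap)
  finally have "\<bar>\<Sum>X\<in>Pow A. \<Sum>Y\<in>Pow A. f (sym_diff X Y) * t X (\<kappa> Y)\<bar> \<le> (\<Sum>b\<in>?K. \<bar>?D b\<bar>)"
    by (simp only: sum_abs)
  also have "\<dots> \<le> (\<Sum>b\<in>?K. c * sqrt (2 ^ card A) * L2_set (?h b) (Pow A))"
  proof (rule sum_mono)
    fix b
    have "\<bar>?D b\<bar> \<le> c * L2_set (\<lambda>X. t X b) (Pow A) * L2_set (?h b) (Pow A)"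
      by (rule convolution_bilinear_bound [OF assms(1) c])
    also have "\<dots> \<le> c * sqrt (2 ^ card A) * L2_set (?h b) (Pow A)"
      by (intro mult_right_mono mult_left_mono norm_t \<open>0 \<le> c\<close>) simp
    finally show "\<bar>?D b\<bar> \<le> c * sqrt (2 ^ card A) * L2_set (?h b) (Pow A)" .
  qed
  \<comment> \<open>The factor 1 is the second vector for Cauchy-Schwarz over the classes.\<close>
  also have "\<dots> = c * sqrt (2 ^ card A) * (\<Sum>b\<in>?K. \<bar>1\<bar> * \<bar>L2_set (?h b) (Pow A)\<bar>)"
    by (simp add: sum_distrib_left)
  also have "\<dots> \<le> c * sqrt (2 ^ card A)
      * (L2_set (\<lambda>_. 1) ?K * L2_set (\<lambda>b. L2_set (?h b) (Pow A)) ?K)"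
    by (intro mult_left_mono L2_set_mult_ineq) (use \<open>0 \<le> c\<close> in simp)
  \<comment> \<open>The squared norms are the class sizes, and the classes partition the
    cube.\<close>
  also have "L2_set (\<lambda>b. L2_set (?h b) (Pow A)) ?K = sqrt (2 ^ card A)"
  proof -
    have sq: "(of_bool P)\<^sup>2 = (of_bool P :: real)" for P
      by (cases P) simp_all
    have "(\<Sum>b\<in>?K. (L2_set (?h b) (Pow A))\<^sup>2) = (\<Sum>b\<in>?K. \<Sum>Y\<in>Pow A. ?h b Y)"
      unfolding L2_set_def by (intro sum.cong refl) (simp add: sum_nonneg sq)
    also have "\<dots> = (\<Sum>Y\<in>Pow A. \<Sum>b\<in>?K. ?h b Y)"
      by (rule sum.swap)
    also have "\<dots> = (\<Sum>Y\<in>Pow A. 1)"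
      by (intro sum.cong refl) (use fin in \<open>simp add: of_bool_def cong: if_cong\<close>)
    finally show ?thesis
      using assms(1) by (simp add: L2_set_def card_Pow)
  qed
  finally show ?thesis
    by (simp add: L2_set_def mult_ac)
qed

section \<open>Middle binomial coefficients and Walsh coefficients of the threshold function\<close>

lemma central_binomial_eq: "(2 * Suc k choose Suc k) = 2 * (Suc (2 * k) choose Suc k)"
  using binomial_symmetric [of k "Suc (2 * k)"] by simp

lemma binomial_middle_even:
  assumes "n \<ge> 1" "even n"
  shows "n choose (n div 2) = 2 * ((n - 1) choose (n div 2))"
proof -
  obtain k where "n = 2 * Suc k"
    using assms by (metis dvdE mult_zero_right not0_implies_Suc not_one_le_zero)
  then show ?thesis
    using central_binomial_eq [of k] by (simp del: binomial_Suc_Suc)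
qed

text \<open>Squaring keeps the bound of order 4^k / sqrt k within the natural numbers. Consecutive
  central coefficients have ratio 2 (2k + 1) / (k + 1), so the induction step reduces to (2k + 1)
  (2k + 3) \<le> 4 (k + 1)^2.\<close>

lemma central_binomial_upper:
  "(2 * k + 1) * (2 * k choose k)\<^sup>2 \<le> (16::nat) ^ k"
proof (induction k)
  case (Suc k)
  have rec: "(k + 1) * (2 * Suc k choose Suc k) = 2 * (2 * k + 1) * (2 * k choose k)"
    using Suc_times_binomial_eq [of "2 * k" k] unfolding central_binomial_eq
    by (simp del: binomial_Suc_Suc add: mult_ac)
  let ?B = "2 * k choose k" and ?B' = "2 * Suc k choose Suc k"
  \<comment> \<open>Multiplying by \<open>(k + 1)\<^sup>2\<close> clears the denominator of the
    recurrence.\<close>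
  have "(k + 1)\<^sup>2 * ((2 * Suc k + 1) * ?B'\<^sup>2) = (2 * k + 3) * ((k + 1) * ?B')\<^sup>2"
    unfolding power_mult_distrib by (simp del: binomial_Suc_Suc add: algebra_simps)
  also have "\<dots> = 4 * ((2 * k + 1) * (2 * k + 3)) * ((2 * k + 1) * ?B\<^sup>2)"
    unfolding rec power2_eq_square by (simp only: mult_ac)
  also have "\<dots> \<le> 4 * (4 * (k + 1)\<^sup>2) * 16 ^ k"
    by (rule mult_mono [OF _ Suc.IH]) (auto simp: power2_eq_square algebra_simps)
  also have "\<dots> = (k + 1)\<^sup>2 * 16 ^ Suc k"
    by simp
  finally show ?case
    by (simp del: binomial_Suc_Suc)
qed simp

text \<open>For even \<open>n\<close> the left side is the central coefficient of \<open>n\<close>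
  itself, and the factor n + 1 of the previous bound is weakened to \<open>n\<close>. For n = 2k + 1
  it is twice the central coefficient of 2k, and 4^n = 4 * 16^k absorbs the square of the 2.\<close>

lemma binomial_middle_upper:
  assumes "n \<ge> 1"
  shows "2 * real ((n - 1) choose (n div 2)) \<le> 2 ^ n / sqrt n"
proof -
  have "n * (2 * ((n - 1) choose (n div 2)))\<^sup>2 \<le> 4 ^ n"
  proof (cases "even n")
    case True
    then have "2 * ((n - 1) choose (n div 2)) = (2 * (n div 2) choose (n div 2))"
      using binomial_middle_even [OF assms] by simp
    then have "n * (2 * ((n - 1) choose (n div 2)))\<^sup>2
        \<le> (2 * (n div 2) + 1) * (2 * (n div 2) choose (n div 2))\<^sup>2"
      using True by simp
    also have "\<dots> \<le> 16 ^ (n div 2)"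
      by (rule central_binomial_upper)
    also have "\<dots> = (4 ^ 2) ^ (n div 2)"
      by simp
    also have "\<dots> = 4 ^ n"
      using True unfolding power_mult [symmetric] by simp
    finally show ?thesis .
  next
    case False
    then obtain k where k: "n = 2 * k + 1"
      by (elim oddE)
    then show ?thesis
      using central_binomial_upper [of k] by (simp add: power_mult power_mult_distrib)
  qed
  then have "real (n * (2 * ((n - 1) choose (n div 2)))\<^sup>2) \<le> 4 ^ n"
    by (metis of_nat_le_iff of_nat_numeral of_nat_power)
  then have "sqrt (real n * (2 * real ((n - 1) choose (n div 2)))\<^sup>2) \<le> sqrt (4 ^ n)"
    by (intro real_sqrt_le_mono) simp
  also have "sqrt (4 ^ n) = 2 ^ n"
    by (simp add: real_sqrt_power)
  finally show ?thesis
    using assms by (simp add: real_sqrt_mult field_simps)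
qed

text \<open>Flipping a coordinate \<open>i \<in> S\<close> changes the sign of \<^term>\<open>walsh S\<close>, so
  only the sets whose value is sensitive to \<open>i\<close> contribute, and these lie on the middle layer.\<close>

lemma walsh_transform_threshold:
  fixes A :: "'a set"
  assumes "finite A" "card A = n" "n \<ge> 1" "S \<subseteq> A"
  defines "f \<equiv> (\<lambda>X::'a set. if 2 * card X \<le> n then 1 else - 1 :: real)"
  shows "\<bar>walsh_transform A f S\<bar> \<le> 2 ^ n / sqrt n"
proof -
  have "\<bar>walsh_transform A f S\<bar> \<le> 2 * real ((n - 1) choose (n div 2))"
  proof (cases "S = {}")
    case True
    let ?M = "{X. X \<subseteq> A \<and> card X = n div 2}"
    \<comment> \<open>With \<open>S\<close> empty there is no sign to flip. Instead \<open>X\<close>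
      is paired with its complement: the two values of \<open>f\<close> cancel except on the layer
      \<open>2 * card X = n\<close>, where both are 1. This layer is empty for odd
      \<open>n\<close>.\<close>
    have bij: "bij_betw ((-) A) (Pow A) (Pow A)"
      by (rule bij_betw_byWitness [where f' = "(-) A"]) auto
    have "2 * (\<Sum>X\<in>Pow A. f X) = (\<Sum>X\<in>Pow A. f X) + (\<Sum>X\<in>Pow A. f (A - X))"
      by (simp add: sum.reindex_bij_betw [OF bij, of f])
    also have "\<dots> = (\<Sum>X\<in>Pow A. 2 * of_bool (2 * card X = n))"
      unfolding sum.distrib [symmetric]
    proof (rule sum.cong)
      fix X assume "X \<in> Pow A"
      then have "card (A - X) = n - card X" "card X \<le> n"
        using assms(1,2) by (auto simp: card_Diff_subset finite_subset card_mono)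
      then show "f X + f (A - X) = 2 * of_bool (2 * card X = n)"
        unfolding f_def by auto
    qed simp
    also have "\<dots> = 2 * real (card {X \<in> Pow A. 2 * card X = n})"
      using assms(1) by (simp add: sum_distrib_left [symmetric] of_bool_def sum.If_cases Int_def)
    finally have eq: "(\<Sum>X\<in>Pow A. f X) = real (card {X \<in> Pow A. 2 * card X = n})"
      by simp
    have "card {X \<in> Pow A. 2 * card X = n} \<le> 2 * ((n - 1) choose (n div 2))"
    proof (cases "even n")
      case True
      then have "{X \<in> Pow A. 2 * card X = n} = ?M" by auto
      then have "card {X \<in> Pow A. 2 * card X = n} = n choose (n div 2)"
        using n_subsets [OF assms(1)] assms(2) by simp
      also have "\<dots> = 2 * ((n - 1) choose (n div 2))"
        by (rule binomial_middle_even [OF assms(3) True])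
      finally show ?thesis by simp
    next
      case False
      then have "{X \<in> Pow A. 2 * card X = n} = {}" by auto
      then show ?thesis by (simp only: card.empty le0)
    qed
    then show ?thesis
      unfolding True walsh_transform_def using eq by simp
  next
    case False
    then obtain i where i: "i \<in> S" by blast
    define B where "B = A - {i}"
    have A: "A = insert i B" "i \<notin> B" "finite B" "card B = n - 1"
      using i assms by (auto simp: B_def)
    have "finite S" using assms by (auto intro: finite_subset)
    have inj: "inj_on (insert i) (Pow B)"
      using A(2) by (auto simp: inj_on_def)
    have "walsh_transform A f S
        = (\<Sum>X\<in>Pow B. f X * walsh S X) + (\<Sum>X\<in>Pow B. f (insert i X) * walsh S (insert i X))"
      unfolding walsh_transform_def A(1) Pow_insert
      by (subst sum.union_disjoint) (use A in \<open>auto simp: sum.reindex [OF inj]\<close>)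
    also have "\<dots> = (\<Sum>X\<in>Pow B. (f X - f (insert i X)) * walsh S X)"
      unfolding sum.distrib [symmetric]
    proof (rule sum.cong)
      fix X assume "X \<in> Pow B"
      then have "i \<notin> X" using A(2) by auto
      then show "f X * walsh S X + f (insert i X) * walsh S (insert i X)
          = (f X - f (insert i X)) * walsh S X"
        using walsh_insert_right [OF \<open>finite S\<close> i] by (simp add: algebra_simps)
    qed simp
    also have "\<bar>\<dots>\<bar> \<le> (\<Sum>X\<in>Pow B. \<bar>f X - f (insert i X)\<bar>)"
      by (rule order_trans [OF sum_abs]) (simp add: abs_mult)
    also have "\<dots> = (\<Sum>X\<in>Pow B. 2 * of_bool (card X = n div 2))"
    proof (rule sum.cong)
      fix X assume "X \<in> Pow B"
      then have "card (insert i X) = Suc (card X)"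
        using A(2,3) by (auto simp: finite_subset card_insert_if)
      \<comment> \<open>The value changes exactly when 2 |X| \<le> n < 2 |X| + 2, which singles out
        \<open>n div 2\<close> for both parities.\<close>
      then show "\<bar>f X - f (insert i X)\<bar> = 2 * of_bool (card X = n div 2)"
        unfolding f_def by (auto simp: of_bool_def)
    qed simp
    also have "\<dots> = 2 * real (card {X. X \<subseteq> B \<and> card X = n div 2})"
      using A(3) by (simp add: sum_distrib_left [symmetric] of_bool_def sum.If_cases Int_def)
    also have "\<dots> = 2 * real ((n - 1) choose (n div 2))"
      using n_subsets [OF A(3)] A(4) by simp
    finally show ?thesis .
  qed
  also have "\<dots> \<le> 2 ^ n / sqrt n"
    by (rule binomial_middle_upper) (rule assms)
  finally show ?thesis .
qed

section \<open>Distinct columns of a matrix over a finite field\<close>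

text \<open>A maximal independent set \<open>U\<close> of columns has \<open>rank L\<close> elements
  and spans all columns, so each column comes from one of the coefficient functions on
  \<open>U\<close>.\<close>

lemma (in vec_space) card_cols_le_rank:
  fixes L :: "'a mat"
  assumes "L \<in> carrier_mat n nc" and fin: "finite (UNIV :: 'a set)"
  shows "card (set (cols L)) \<le> CARD('a) ^ rank L"
proof -
  let ?C = "set (cols L)"
  have C: "?C \<subseteq> carrier_vec n"
    using cols_dim assms(1) by blast
  obtain U where U: "finite U" "maximal U (\<lambda>T. T \<subseteq> ?C \<and> lin_indpt T)"
    using maximal_exists_superset [of ?C "\<lambda>T. T \<subseteq> ?C \<and> lin_indpt T" "{}"]
    by (auto simp: finite_lin_indpt2)
  then have UC: "U \<subseteq> ?C" and indep: "lin_indpt U"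
    by (simp_all add: maximal_def)
  have Uc: "U \<subseteq> carrier_vec n" using UC C by blast
  have sub: "?C \<subseteq> span U"
  proof (rule subsetI, rule ccontr)
    fix s assume s: "s \<in> ?C" "s \<notin> span U"
    then have "s \<notin> U" using Uc span_mem by auto
    moreover have "lin_indpt (U \<union> {s})"
      using lin_dep_iff_in_span [of U s] s Uc C indep \<open>s \<notin> U\<close> by auto
    ultimately show False
      using U(2) s UC by (auto simp: maximal_def)
  qed
  let ?E = "U \<rightarrow>\<^sub>E (UNIV :: 'a set)"
  have "span U \<subseteq> (\<lambda>a. lincomb a U) ` ?E"
  proof
    fix v assume "v \<in> span U"
    then obtain a where v: "v = lincomb a U"
      using finite_in_span [OF U(1) Uc] by blast
    \<comment> \<open>Only the coefficients on \<open>U\<close> matter; restricting them places the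
      function in the finite set \<open>?E\<close>.\<close>
    have "lincomb a U = lincomb (restrict a U) U"
      by (rule lincomb_cong) (use Uc in auto)
    then show "v \<in> (\<lambda>a. lincomb a U) ` ?E"
      using v by auto
  qed
  with sub have "card ?C \<le> card ((\<lambda>a. lincomb a U) ` ?E)"
    by (intro card_mono) (auto intro!: finite_imageI finite_PiE U fin)
  also have "\<dots> \<le> card ?E"
    by (intro card_image_le finite_PiE U fin)
  also have "\<dots> = CARD('a) ^ card U"
    by (simp add: card_PiE U)
  also have "card U = rank L"
    using rank_card_indpt [OF assms(1) U(2)] by simp
  finally show ?thesis .
qed

section \<open>From binary indices to subsets, and the error count\<close>

definition bits_upto :: "nat \<Rightarrow> nat \<Rightarrow> nat set" where
  "bits_upto n x = {k. k < n \<and> bit x k}"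

text \<open>A number below \<open>2 ^ n\<close> is recovered from its lowest \<open>n\<close> bits;
  surjectivity then follows by counting.\<close>

lemma bij_betw_bits_upto: "bij_betw (bits_upto n) {..<2 ^ n} (Pow {..<n})"
proof -
  have inj: "inj_on (bits_upto n) {..<2 ^ n}"
  proof (rule inj_onI)
    fix x y :: nat assume xy: "x \<in> {..<2 ^ n}" "y \<in> {..<2 ^ n}" "bits_upto n x = bits_upto n y"
    have "take_bit n x = take_bit n y"
      using xy(3) by (auto simp: bit_eq_iff bit_take_bit_iff bits_upto_def set_eq_iff)
    then show "x = y"
      using xy by (simp add: take_bit_nat_eq_self)
  qed
  have "bits_upto n ` {..<2 ^ n} = Pow {..<n}"
    by (rule card_subset_eq) (simp_all add: card_image [OF inj] card_Pow, auto simp: bits_upto_def)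
  with inj show ?thesis by (simp add: bij_betw_def)
qed

lemma hamming_dist_bits_upto:
  "hamming_dist n x y = card (sym_diff (bits_upto n x) (bits_upto n y))"
  unfolding hamming_dist_def bits_upto_def by (rule arg_cong [where f = card]) auto

text \<open>Both matrices have entries 1 and -1, so their entrywise products sum to
  \<open>4 ^ n\<close> minus twice the number of errors. An upper bound on this correlation is thus
  a lower bound on the errors.\<close>

lemma bool_errors_distance_mat:
  fixes L :: "'p::prime_card mod_ring mat"
  assumes "n \<ge> 1" "L \<in> carrier_mat (2 ^ n) (2 ^ n)"
  shows "real (bool_errors (distance_mat n) L)
    \<ge> 4 ^ n * (1 / 2 - sqrt (CARD('p) ^ vec_space.rank (2 ^ n) L) / (2 * sqrt n))"
proof -
  let ?A = "{..<n}" and ?N = "{..<2 ^ n :: nat}"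
  let ?M = "\<lambda>x y. distance_mat n $$ (x, y)" and ?B = "\<lambda>x y. bool_sign (L $$ (x, y))"
  define dec where "dec = the_inv_into ?N (bits_upto n)"
  have dec: "bij_betw dec (Pow ?A) ?N"
    unfolding dec_def by (rule bij_betw_the_inv_into [OF bij_betw_bits_upto])
  have bits_dec: "bits_upto n (dec X) = X" if "X \<subseteq> ?A" for X
    unfolding dec_def using that bij_betw_bits_upto [of n]
    by (intro f_the_inv_into_f_bij_betw) auto
  have dec_lt: "dec X < 2 ^ n" if "X \<subseteq> ?A" for X
    using bij_betwE [OF dec] that by auto
  define f where "f = (\<lambda>X::nat set. if 2 * card X \<le> n then 1 else - 1 :: real)"
  \<comment> \<open>The class of \<open>Y\<close> is the column vector of \<open>L\<close> itself,
    and \<open>t\<close> reads off its sign in row \<open>X\<close>. Thus the number of classes is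
    at most the number of distinct columns.\<close>
  define t :: "nat set \<Rightarrow> 'p mod_ring vec \<Rightarrow> real"
    where "t = (\<lambda>X v. of_int (bool_sign (v $ dec X)))"
  define \<kappa> where "\<kappa> = (\<lambda>Y. col L (dec Y))"
  let ?corr = "\<Sum>X\<in>Pow ?A. \<Sum>Y\<in>Pow ?A. f (sym_diff X Y) * t X (\<kappa> Y)"
  have "\<kappa> ` Pow ?A \<subseteq> set (cols L)"
    using assms(2) dec_lt by (auto simp: \<kappa>_def cols_def)
  then have "card (\<kappa> ` Pow ?A) \<le> card (set (cols L))"
    by (rule card_mono [rotated]) simp
  also have "\<dots> \<le> CARD('p) ^ vec_space.rank (2 ^ n) L"
    using vec_space.card_cols_le_rank [OF assms(2)] by simp
  finally have classes: "card (\<kappa> ` Pow ?A) \<le> CARD('p) ^ vec_space.rank (2 ^ n) L" .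
  have "\<bar>?corr\<bar> \<le> 2 ^ n / sqrt n * 2 ^ card ?A * sqrt (card (\<kappa> ` Pow ?A))"
  proof (rule correlation_few_classes)
    show "\<bar>walsh_transform ?A f S\<bar> \<le> 2 ^ n / sqrt n" if "S \<subseteq> ?A" for S
      unfolding f_def by (rule walsh_transform_threshold) (use assms(1) that in auto)
    show "\<bar>t X b\<bar> \<le> 1" for X b
      by (simp add: t_def bool_sign_def)
  qed simp
  also have "\<dots> = 4 ^ n * sqrt (card (\<kappa> ` Pow ?A)) / sqrt n"
    by (simp flip: power_mult_distrib)
  also have "\<dots> \<le> 4 ^ n * sqrt (CARD('p) ^ vec_space.rank (2 ^ n) L) / sqrt n"
    using classes by (intro divide_right_mono mult_left_mono real_sqrt_le_mono) (auto simp flip: of_nat_power)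
  finally have bound: "?corr \<le> 4 ^ n * sqrt (CARD('p) ^ vec_space.rank (2 ^ n) L) / sqrt n"
    by simp
  have entry: "f (sym_diff X Y) * t X (\<kappa> Y) = of_int (?M (dec X) (dec Y) * ?B (dec X) (dec Y))"
    if "X \<subseteq> ?A" "Y \<subseteq> ?A" for X Y
    using that dec_lt [OF that(1)] dec_lt [OF that(2)] assms(2)
    by (auto simp: f_def t_def \<kappa>_def distance_mat_def hamming_dist_bits_upto bits_dec)
  have "?corr = (\<Sum>X\<in>Pow ?A. \<Sum>Y\<in>Pow ?A. of_int (?M (dec X) (dec Y) * ?B (dec X) (dec Y)))"
    by (intro sum.cong refl entry) auto
  also have "\<dots> = (\<Sum>x\<in>?N. \<Sum>y\<in>?N. of_int (?M x y * ?B x y))"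
    by (subst sum.reindex_bij_betw [OF dec, symmetric], intro sum.cong refl)
      (rule sum.reindex_bij_betw [OF dec])
  \<comment> \<open>A product of two signs is 1 if they agree and -1 if they differ.\<close>
  also have "\<dots> = (\<Sum>x\<in>?N. \<Sum>y\<in>?N. 1 - 2 * of_bool (?M x y \<noteq> ?B x y))"
    by (intro sum.cong refl) (auto simp: distance_mat_def bool_sign_def)
  also have "\<dots> = (\<Sum>z\<in>?N \<times> ?N. 1 - 2 * of_bool (?M (fst z) (snd z) \<noteq> ?B (fst z) (snd z)))"
    by (simp add: sum.cartesian_product split_def)
  also have "\<dots> = 4 ^ n - 2 * (\<Sum>z\<in>?N \<times> ?N. of_bool (?M (fst z) (snd z) \<noteq> ?B (fst z) (snd z)))"
    by (simp add: sum_subtractf sum_distrib_left flip: power_mult_distrib)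
  also have "(\<Sum>z\<in>?N \<times> ?N. of_bool (?M (fst z) (snd z) \<noteq> ?B (fst z) (snd z)))
      = real (card {z \<in> ?N \<times> ?N. ?M (fst z) (snd z) \<noteq> ?B (fst z) (snd z)})"
    by (simp add: of_bool_def sum.If_cases Int_def)
  also have "{z \<in> ?N \<times> ?N. ?M (fst z) (snd z) \<noteq> ?B (fst z) (snd z)}
      = {(i, j). i < dim_row (distance_mat n) \<and> j < dim_col (distance_mat n) \<and> ?M i j \<noteq> ?B i j}"
    by (auto simp: distance_mat_def)
  also have "card \<dots> = bool_errors (distance_mat n) L"
    by (simp add: bool_errors_def)
  finally have "?corr = 4 ^ n - 2 * real (bool_errors (distance_mat n) L)" .
  with bound show ?thesis
    by (simp add: field_simps)
qed

section \<open>Rigidity and the choice of the rank bound\<close>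

text \<open>The zero matrix is admissible because \<open>r\<close> is nonnegative, so the
  \<open>LEAST\<close> in the definition ranges over a nonempty set and some matrix realises
  it.\<close>

lemma bool_rigidity_attained:
  assumes "r \<ge> 0"
  obtains L :: "'p::prime_card mod_ring mat"
  where "L \<in> carrier_mat (dim_row A) (dim_col A)" "real (vec_space.rank (dim_row A) L) \<le> r"
    "bool_rigidity TYPE('p) A r = bool_errors A L"
proof -
  let ?P = "\<lambda>k. \<exists>L :: 'p mod_ring mat. L \<in> carrier_mat (dim_row A) (dim_col A) \<and>
        real (vec_space.rank (dim_row A) L) \<le> r \<and> k = bool_errors A L"
  have "?P (bool_errors A (0\<^sub>m (dim_row A) (dim_col A) :: 'p mod_ring mat))"
    using assms by (intro exI [of _ "0\<^sub>m (dim_row A) (dim_col A)"]) (simp add: vec_space.rank_0I)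
  then have "?P (LEAST k. ?P k)"
    by (rule LeastI [of ?P])
  then show thesis
    using that unfolding bool_rigidity_def by blast
qed

theorem theorem1p3:
  fixes \<epsilon> :: real
  assumes "\<epsilon> > 0"
  shows "\<exists>\<beta>::real. \<beta> > 0 \<and>
    (\<forall>n::nat. n \<ge> 1 \<longrightarrow>
       real (bool_rigidity TYPE('p::prime_card) (distance_mat n) (\<beta> * log 2 (real n)))
         \<ge> 4 ^ n * (1 / 2 - 1 / real n powr (1 / 2 - \<epsilon>)))"
proof -
  let ?p = "real CARD('p)"
  have "CARD('p) > 1"
    using prime_card [where 'a = 'p] by (rule prime_gt_1_nat)
  then have p: "?p > 1" by simp
  define \<beta> where "\<beta> = 2 * \<epsilon> / log 2 ?p"
  have "\<beta> > 0" using assms p by (simp add: \<beta>_def)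
  moreover have "real (bool_rigidity TYPE('p) (distance_mat n) (\<beta> * log 2 (real n)))
         \<ge> 4 ^ n * (1 / 2 - 1 / real n powr (1 / 2 - \<epsilon>))" if n: "n \<ge> 1" for n
  proof -
    have dim: "dim_row (distance_mat n) = 2 ^ n" "dim_col (distance_mat n) = 2 ^ n"
      by (simp_all add: distance_mat_def)
    \<comment> \<open>For n = 1 the rank bound is 0, which still admits the zero matrix.\<close>
    have "\<beta> * log 2 (real n) \<ge> 0" using \<open>\<beta> > 0\<close> n by simp
    then obtain L :: "'p mod_ring mat" where L: "L \<in> carrier_mat (2 ^ n) (2 ^ n)"
      "real (vec_space.rank (2 ^ n) L) \<le> \<beta> * log 2 (real n)"
      "bool_rigidity TYPE('p) (distance_mat n) (\<beta> * log 2 (real n)) = bool_errors (distance_mat n) L"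
      by (rule bool_rigidity_attained [where A = "distance_mat n"]) (auto simp: dim)
    let ?r = "vec_space.rank (2 ^ n) L"
    have "sqrt (?p ^ ?r) = ?p powr (real ?r / 2)"
      using p by (simp add: powr_half_sqrt [symmetric] powr_powr flip: powr_realpow)
    also have "\<dots> \<le> ?p powr (\<beta> * log 2 (real n) / 2)"
      using L(2) p by (intro powr_mono) auto
    \<comment> \<open>This identity dictates the value of \<open>\<beta>\<close>: the 2 undoes the
      halving caused by the square root, and \<open>log 2 ?p\<close> converts the base.\<close>
    also have "\<dots> = real n powr \<epsilon>"
      using p n by (simp add: \<beta>_def powr_def log_def)
    \<comment> \<open>The spare factor 2 in the denominator is given away here.\<close>
    finally have "sqrt (?p ^ ?r) / (2 * sqrt n) \<le> real n powr \<epsilon> / sqrt n"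
      using n by (intro frac_le) auto
    also have "\<dots> = 1 / real n powr (1 / 2 - \<epsilon>)"
      using n by (simp add: powr_diff powr_half_sqrt)
    finally have "4 ^ n * (1 / 2 - 1 / real n powr (1 / 2 - \<epsilon>))
        \<le> 4 ^ n * (1 / 2 - sqrt (?p ^ ?r) / (2 * sqrt n))"
      by (intro mult_left_mono) auto
    also have "\<dots> \<le> real (bool_errors (distance_mat n) L)"
      using bool_errors_distance_mat [OF n L(1)] by simp
    finally show ?thesis by (simp add: L(3))
  qed
  ultimately show ?thesis by blast
qed

end
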